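(* Let $K$ be a positive (i.e. $K\ge0$), radially symmetric kernel on $\mathbb{R}^d$ with rapid decay and unit mass, whose Fourier transform satisfies $\widehat{K}\ge 0$. Let $k>0$, let $\phi^0:\mathbb{R}^d\to\mathbb{R}$ be bounded and continuous, and let $\phi^n$, $n\ge 0$, be generated by the weighted median filter scheme $$\phi^{n+1}(x)=\mathbf{M}_{K_{\sqrt{2k}}}\phi^n(x).$$ Then the scheme dissipates the non-local energy $\mathcal{E}_{K_{\sqrt{2k}}}$, i.e. for every $n\ge0$ $$\mathcal{E}_{K_{\sqrt{2k}}}(\phi^{n+1})\le\mathcal{E}_{K_{\sqrt{2k}}}(\phi^n),$$ where for a kernel $L$, $$\mathcal{E}_L(\phi)=\iint L(x-y)\,|\phi(x)-\phi(y)|\,dx\,dy\in[0,\infty].$$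
   Context: For $r>0$, $K_r(x)=r^{-d}K(x/r)$. Rapid decay means decay at infinity faster than any power of $|x|$; unit mass means $\int_{\mathbb{R}^d}K=1$. For $\lambda\in\mathbb{R}$ and bounded continuous $\phi$, $\mathbf{T}_\lambda\phi=\{x:\phi(x)\ge\lambda\}$. For a kernel $L\ge 0$ of unit mass, $\psi_L\phi(x,\lambda)=\int_{\mathbf{T}_\lambda\phi}L(x-y)\,dy$, and the weighted median of $\phi$ at $x$ is $$\mathbf{M}_L\phi(x)=\sup\{\lambda\in\mathbb{R}:\psi_L\phi(x,\lambda)\ge\tfrac12\}.$$ (If $\phi$ is bounded and continuous, so is $\mathbf{M}_L\phi$, so the scheme is well defined.) *)

theory Defs
  imports "HOL-Analysis.Analysis" "HOL-Library.Nonpos_Ints"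
begin

definition radially_symmetric :: "('a::real_normed_vector \<Rightarrow> real) \<Rightarrow> bool" where
  "radially_symmetric K \<longleftrightarrow> (\<forall>x y. norm x = norm y \<longrightarrow> K x = K y)"

definition rapid_decay :: "('a::real_normed_vector \<Rightarrow> real) \<Rightarrow> bool" where
  "rapid_decay K \<longleftrightarrow> (\<forall>N::nat. ((\<lambda>x. norm x ^ N * K x) \<longlongrightarrow> 0) at_infinity)"

definition unit_mass :: "('a::euclidean_space \<Rightarrow> real) \<Rightarrow> bool" where
  "unit_mass K \<longleftrightarrow> integrable lebesgue K \<and> (LINT x|lebesgue. K x) = 1"

text \<open>The normalisation of the frequency variable does not affect the sign of the transform.\<close>

definition fourier :: "('a::euclidean_space \<Rightarrow> real) \<Rightarrow> 'a \<Rightarrow> complex" where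
  "fourier K \<xi> = (LINT x|lebesgue. complex_of_real (K x) * cis (- (\<xi> \<bullet> x)))"

definition rescale :: "real \<Rightarrow> ('a::euclidean_space \<Rightarrow> real) \<Rightarrow> 'a \<Rightarrow> real" where
  "rescale r K x = K (x /\<^sub>R r) / r ^ DIM('a)"

definition superlevel :: "real \<Rightarrow> ('a \<Rightarrow> real) \<Rightarrow> 'a set" where
  "superlevel c \<phi> = {x. \<phi> x \<ge> c}"

definition superlevel_weight ::
    "('a::euclidean_space \<Rightarrow> real) \<Rightarrow> ('a \<Rightarrow> real) \<Rightarrow> 'a \<Rightarrow> real \<Rightarrow> real" where
  "superlevel_weight L \<phi> x c = (LINT y:superlevel c \<phi>|lebesgue. L (x - y))"

text \<open>For \<open>L \<ge> 0\<close> of unit mass and \<open>\<phi>\<close> bounded and measurable, the set below is nonempty and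
  bounded above, so \<open>Sup\<close> is the genuine real supremum.\<close>

definition weighted_median ::
    "('a::euclidean_space \<Rightarrow> real) \<Rightarrow> ('a \<Rightarrow> real) \<Rightarrow> 'a \<Rightarrow> real" where
  "weighted_median L \<phi> x = Sup {c. superlevel_weight L \<phi> x c \<ge> 1 / 2}"

definition nonlocal_energy ::
    "('a::euclidean_space \<Rightarrow> real) \<Rightarrow> ('a \<Rightarrow> real) \<Rightarrow> ennreal" where
  "nonlocal_energy L \<phi> =
     (\<integral>\<^sup>+ y. (\<integral>\<^sup>+ x. ennreal (L (x - y) * \<bar>\<phi> x - \<phi> y\<bar>) \<partial>lebesgue) \<partial>lebesgue)"

end

(* Pass to an even Borel representative J of the rescaled kernel. The superlevel set at height c of
   the median of phi is {x. 1/2 <= (J * 1_T)(x)} where T is the superlevel set of phi at height c.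
   So by the layer cake formula it is enough to show that the threshold step T -> T' dissipates the
   energy of indicator functions. With u = 1_T, u' = 1_T' and w = u' - u,
     |u'(x)-u'(y)| = |u(x)-u(y)| + w(x)(1-2u(y)) + w(y)(1-2u(x)) - 2 w(x)w(y);
   integrated against J(x-y), the two middle terms give 2 <w, 1 - 2 J*u> <= 0, and <w, J*w> >= 0
   because J has a nonnegative Fourier transform. If the energy of u is finite, then w is integrable,
   since |w(x)| is at most twice the integral over y of J(x-y)|u(x)-u(y)|.
   Positivity of <w, J*w> uses no Fourier inversion: it is the value at 0 of a bounded,
   continuous, integrable function with nonnegative transform, tested against shrinking Gaussians. *)
theory Submission
  imports Defs "HOL-Probability.Probability"
begin

subsection \<open>Lebesgue measure and translations\<close>

lemma nn_integral_lborel_affine: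
  fixes f :: "'a::euclidean_space \<Rightarrow> ennreal"
  assumes [measurable]: "f \<in> borel_measurable borel" and "c \<noteq> 0"
  shows "(\<integral>\<^sup>+x. f x \<partial>lborel) = ennreal (\<bar>c\<bar> ^ DIM('a)) * (\<integral>\<^sup>+x. f (t + c *\<^sub>R x) \<partial>lborel)"
  by (subst lborel_affine[OF \<open>c \<noteq> 0\<close>, of t])
     (simp add: nn_integral_density nn_integral_distr nn_integral_cmult)

lemma integrable_lborel_affine:
  fixes f :: "'a::euclidean_space \<Rightarrow> 'b::{banach, second_countable_topology}"
  assumes "integrable lborel f" and "c \<noteq> 0"
  shows "integrable lborel (\<lambda>x. f (t + c *\<^sub>R x))"
proof -
  have [measurable]: "f \<in> borel_measurable borel"
    using assms(1) by auto
  have "(\<integral>\<^sup>+x. ennreal (norm (f x)) \<partial>lborel) < \<infinity>"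
    using assms(1) by (simp add: integrable_iff_bounded)
  then have "(\<integral>\<^sup>+x. ennreal (norm (f (t + c *\<^sub>R x))) \<partial>lborel) < \<infinity>"
    using assms(2)
    by (subst (asm) nn_integral_lborel_affine[of _ c t]) (auto simp: ennreal_mult_less_top)
  then show ?thesis
    by (simp add: integrable_iff_bounded)
qed

lemma integral_lborel_affine:
  fixes f :: "'a::euclidean_space \<Rightarrow> 'b::{banach, second_countable_topology}"
  assumes [measurable]: "f \<in> borel_measurable borel" and "c \<noteq> 0"
  shows "(\<integral>x. f x \<partial>lborel) = \<bar>c\<bar> ^ DIM('a) *\<^sub>R (\<integral>x. f (t + c *\<^sub>R x) \<partial>lborel)"
  by (subst lborel_affine[OF \<open>c \<noteq> 0\<close>, of t]) (simp add: integral_density integral_distr)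

text \<open>Enclose the exceptional set in a Borel null set; by the change of variables its preimage
  under the affine map is null as well.\<close>

lemma AE_lborel_affine:
  fixes P :: "'a::euclidean_space \<Rightarrow> bool"
  assumes "AE x in lborel. P x" and "c \<noteq> 0"
  shows "AE x in lborel. P (t + c *\<^sub>R x)"
proof -
  obtain N where N: "{x. \<not> P x} \<subseteq> N" "N \<in> null_sets lborel"
    using assms(1) by (auto elim!: AE_E simp: null_sets_def)
  then have [measurable]: "N \<in> sets borel" by auto
  have "(\<integral>\<^sup>+x. indicator N x \<partial>lborel) = 0"
    using N by (simp add: null_sets_def)
  then have "(\<integral>\<^sup>+x. indicator N (t + c *\<^sub>R x) \<partial>lborel) = 0"
    using assms(2) by (subst (asm) nn_integral_lborel_affine[of _ c t]) auto
  then have "AE x in lborel. (indicator N (t + c *\<^sub>R x) :: ennreal) = 0"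
    by (subst (asm) nn_integral_0_iff_AE) auto
  then show ?thesis
    by (rule eventually_mono) (use N(1) in \<open>auto simp: indicator_def split: if_splits\<close>)
qed

lemmas integrable_lborel_reflect = integrable_lborel_affine[of _ "-1", simplified]
lemmas integral_lborel_reflect = integral_lborel_affine[of _ "-1", simplified]
lemmas integrable_lborel_translate = integrable_lborel_affine[of _ 1, simplified]
lemmas integral_lborel_translate = integral_lborel_affine[of _ 1, simplified]

section \<open>Continuity of translation in L1\<close>

lemma tendsto_L1_translation_approx:
  fixes f :: "'a::euclidean_space \<Rightarrow> real"
  assumes f: "integrable lborel f"
    and approx: "\<And>e. e > 0 \<Longrightarrow> \<exists>g. integrable lborel g \<and>
        ((\<lambda>h. \<integral>x. \<bar>g (h + x) - g x\<bar> \<partial>lborel) \<longlongrightarrow> 0) (at 0) \<and> (\<integral>x. \<bar>f x - g x\<bar> \<partial>lborel) < e"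
  shows "((\<lambda>h. \<integral>x. \<bar>f (h + x) - f x\<bar> \<partial>lborel) \<longlongrightarrow> 0) (at 0)"
proof (rule tendstoI)
  fix e :: real assume "e > 0"
  then obtain g where g: "integrable lborel g"
      and lim: "((\<lambda>h. \<integral>x. \<bar>g (h + x) - g x\<bar> \<partial>lborel) \<longlongrightarrow> 0) (at 0)"
      and fg: "(\<integral>x. \<bar>f x - g x\<bar> \<partial>lborel) < e / 4"
    using approx[of "e / 4"] by auto
  have [measurable]: "f \<in> borel_measurable borel" "g \<in> borel_measurable borel"
    using f g by auto
  \<comment> \<open>Triangle inequality through \<open>g (h + x)\<close> and \<open>g x\<close>. By
    translation invariance the two approximation errors are equal, whence the factor 2 and the
    choice of \<open>e / 4\<close>.\<close>
  have bound: "(\<integral>x. \<bar>f (h + x) - f x\<bar> \<partial>lborel)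
      \<le> 2 * (\<integral>x. \<bar>f x - g x\<bar> \<partial>lborel) + (\<integral>x. \<bar>g (h + x) - g x\<bar> \<partial>lborel)" for h
  proof -
    note [simp] = f g integrable_lborel_translate[OF f] integrable_lborel_translate[OF g]
    have "(\<integral>x. \<bar>f (h + x) - f x\<bar> \<partial>lborel)
       \<le> (\<integral>x. \<bar>f (h + x) - g (h + x)\<bar> + \<bar>f x - g x\<bar> + \<bar>g (h + x) - g x\<bar> \<partial>lborel)"
      by (rule integral_mono) auto
    also have "\<dots> = (\<integral>x. \<bar>f (h + x) - g (h + x)\<bar> \<partial>lborel) + (\<integral>x. \<bar>f x - g x\<bar> \<partial>lborel)
        + (\<integral>x. \<bar>g (h + x) - g x\<bar> \<partial>lborel)"
      by (subst Bochner_Integration.integral_add, auto)+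
    also have "(\<integral>x. \<bar>f (h + x) - g (h + x)\<bar> \<partial>lborel) = (\<integral>x. \<bar>f x - g x\<bar> \<partial>lborel)"
      by (rule integral_lborel_translate[symmetric]) auto
    finally show ?thesis by simp
  qed
  have "eventually (\<lambda>h. (\<integral>x. \<bar>g (h + x) - g x\<bar> \<partial>lborel) < e / 2) (at 0)"
    using lim \<open>e > 0\<close> by (intro order_tendstoD(2)) auto
  then show "eventually (\<lambda>h. dist (\<integral>x. \<bar>f (h + x) - f x\<bar> \<partial>lborel) 0 < e) (at 0)"
  proof (rule eventually_mono)
    fix h assume "(\<integral>x. \<bar>g (h + x) - g x\<bar> \<partial>lborel) < e / 2"
    with bound[of h] fg have "(\<integral>x. \<bar>f (h + x) - f x\<bar> \<partial>lborel) < e"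
      by linarith
    then show "dist (\<integral>x. \<bar>f (h + x) - f x\<bar> \<partial>lborel) 0 < e"
      by simp
  qed
qed

text \<open>Reduces to dominated convergence of sequences: in a first countable space a limit at
  \<open>a\<close> can be tested along sequences that avoid \<open>a\<close>.\<close>

lemma integral_dominated_convergence_at:
  fixes s :: "'b::first_countable_topology \<Rightarrow> 'a \<Rightarrow> 'c::{banach, second_countable_topology}"
  assumes "f \<in> borel_measurable M" "\<And>h. s h \<in> borel_measurable M" "integrable M w"
    and lim: "AE x in M. ((\<lambda>h. s h x) \<longlongrightarrow> f x) (at a)"
    and bound: "\<And>h. AE x in M. norm (s h x) \<le> w x"
  shows "((\<lambda>h. integral\<^sup>L M (s h)) \<longlongrightarrow> integral\<^sup>L M f) (at a)"
  unfolding tendsto_at_iff_sequentially comp_def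
proof (intro allI impI)
  fix X assume X: "\<forall>i. X i \<in> UNIV - {a}" "X \<longlonglongrightarrow> a"
  show "(\<lambda>i. integral\<^sup>L M (s (X i))) \<longlonglongrightarrow> integral\<^sup>L M f"
  proof (rule integral_dominated_convergence)
    show "AE x in M. (\<lambda>i. s (X i) x) \<longlonglongrightarrow> f x"
      using lim X by (auto elim!: eventually_mono simp: tendsto_at_iff_sequentially comp_def)
  qed (use assms(1-3,5) in auto)
qed

text \<open>Once the absolute value is expanded, only the overlap of \<open>U\<close> with its
  translate depends on \<open>h\<close>. Points of the open set \<open>U\<close> stay in
  \<open>U\<close> under small shifts, and outside \<open>U\<close> the second factor vanishes, so
  the overlap converges pointwise even on the boundary, dominated by the indicator of
  \<open>U\<close>.\<close>

lemma tendsto_L1_translation_open: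
  fixes U :: "'a::euclidean_space set"
  assumes "open U" and "emeasure lborel U < \<infinity>"
  shows "((\<lambda>h. \<integral>x. \<bar>indicat_real U (h + x) - indicat_real U x\<bar> \<partial>lborel) \<longlongrightarrow> 0) (at 0)"
proof -
  have [measurable]: "U \<in> sets borel"
    using assms(1) by simp
  have U: "integrable lborel (indicat_real U)"
    using assms(2) by (simp add: integrable_indicator_iff)
  note Uh = integrable_lborel_translate[OF U]
  have UUh: "integrable lborel (\<lambda>x. indicat_real U (h + x) * indicat_real U x)" for h
    by (rule Bochner_Integration.integrable_bound[OF U]) (auto simp: indicator_def)
  have "(\<integral>x. \<bar>indicat_real U (h + x) - indicat_real U x\<bar> \<partial>lborel)
      = 2 * ((\<integral>x. indicat_real U x \<partial>lborel) - (\<integral>x. indicat_real U (h + x) * indicat_real U x \<partial>lborel))" for h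
  proof -
    have "(\<integral>x. \<bar>indicat_real U (h + x) - indicat_real U x\<bar> \<partial>lborel)
       = (\<integral>x. indicat_real U (h + x) + indicat_real U x - 2 * (indicat_real U (h + x) * indicat_real U x) \<partial>lborel)"
      by (rule Bochner_Integration.integral_cong) (auto simp: indicator_def)
    also have "\<dots> = (\<integral>x. indicat_real U (h + x) \<partial>lborel) + (\<integral>x. indicat_real U x \<partial>lborel)
        - 2 * (\<integral>x. indicat_real U (h + x) * indicat_real U x \<partial>lborel)"
      using U Uh UUh by simp
    also have "(\<integral>x. indicat_real U (h + x) \<partial>lborel) = (\<integral>x. indicat_real U x \<partial>lborel)"
      by (rule integral_lborel_translate[symmetric]) auto
    finally show ?thesis by simp
  qed
  moreover have "((\<lambda>h. \<integral>x. indicat_real U (h + x) * indicat_real U x \<partial>lborel)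
      \<longlongrightarrow> (\<integral>x. indicat_real U x \<partial>lborel)) (at 0)"
  proof (rule integral_dominated_convergence_at)
    show "integrable lborel (indicat_real U)" by (rule U)
    show "AE x in lborel. ((\<lambda>h. indicat_real U (h + x) * indicat_real U x) \<longlongrightarrow> indicat_real U x) (at 0)"
    proof (rule AE_I2)
      fix x
      show "((\<lambda>h. indicat_real U (h + x) * indicat_real U x) \<longlongrightarrow> indicat_real U x) (at 0)"
      proof (cases "x \<in> U")
        case True
        have "((\<lambda>h. h + x) \<longlongrightarrow> 0 + x) (at 0)"
          by (intro tendsto_intros)
        then have "eventually (\<lambda>h. h + x \<in> U) (at 0)"
          using True \<open>open U\<close> by (intro topological_tendstoD) auto
        then show ?thesis
          by (intro tendsto_eventually) (auto elim!: eventually_mono simp: True)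
      qed simp
    qed
  qed (auto simp: indicator_def)
  ultimately show ?thesis
    by (auto intro!: tendsto_eq_intros)
qed

text \<open>Induction over integrable functions: Borel sets of finite measure are approximated from
  outside by open sets, sums follow from the triangle inequality, and limits are again
  approximations in L1.\<close>

theorem tendsto_L1_translation:
  fixes f :: "'a::euclidean_space \<Rightarrow> real"
  assumes "integrable lborel f"
  shows "((\<lambda>h. \<integral>x. \<bar>f (h + x) - f x\<bar> \<partial>lborel) \<longlongrightarrow> 0) (at 0)"
  using assms
proof (induction rule: integrable_induct)
  case (base A c)
  have A: "integrable lborel (indicat_real A)"
    using base by (simp add: integrable_indicator_iff)
  have "((\<lambda>h. \<integral>x. \<bar>indicat_real A (h + x) - indicat_real A x\<bar> \<partial>lborel) \<longlongrightarrow> 0) (at 0)"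
  proof (rule tendsto_L1_translation_approx[OF A])
    fix e :: real assume e: "e > 0"
    have "A \<in> sets lebesgue" using base by auto
    then obtain U where U: "open U" "A \<subseteq> U" "U - A \<in> lmeasurable" "emeasure lebesgue (U - A) < ennreal e"
      using sets_lebesgue_outer_open[OF _ e] by metis
    have [measurable]: "U \<in> sets borel" "A \<in> sets borel" using U base by auto
    have less: "emeasure lborel (U - A) < ennreal e" using U(4) by simp
    have "emeasure lborel U = emeasure lborel A + emeasure lborel (U - A)"
      using U(2) by (subst plus_emeasure) (auto intro: arg_cong[where f="emeasure lborel"])
    then have fin: "emeasure lborel U < \<infinity>"
      using base less by (simp add: ennreal_add_less_top) (metis ennreal_less_top less_trans)
    have "(\<integral>x. \<bar>indicat_real A x - indicat_real U x\<bar> \<partial>lborel) = (\<integral>x. indicat_real (U - A) x \<partial>lborel)"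
      using U(2) by (intro Bochner_Integration.integral_cong) (auto simp: indicator_def)
    also have "\<dots> = measure lborel (U - A)" by simp
    also have "\<dots> < e" using less e
      by (metis emeasure_eq_ennreal_measure ennreal_less_iff measure_nonneg top.not_eq_extremum ennreal_less_top less_trans)
    finally show "\<exists>g. integrable lborel g \<and>
        ((\<lambda>h. \<integral>x. \<bar>g (h + x) - g x\<bar> \<partial>lborel) \<longlongrightarrow> 0) (at 0) \<and> (\<integral>x. \<bar>indicat_real A x - g x\<bar> \<partial>lborel) < e"
      using fin tendsto_L1_translation_open[OF U(1) fin]
      by (intro exI[of _ "indicat_real U"]) (auto simp: integrable_indicator_iff)
  qed
  from tendsto_mult_right_zero[OF this, of "\<bar>c\<bar>"] show ?case
    by (simp flip: left_diff_distrib right_diff_distrib integral_mult_right_zero abs_mult add: mult.commute)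
next
  case (add f g)
  have "((\<lambda>h. (\<integral>x. \<bar>f (h + x) - f x\<bar> \<partial>lborel) + (\<integral>x. \<bar>g (h + x) - g x\<bar> \<partial>lborel)) \<longlongrightarrow> 0) (at 0)"
    using add by (auto intro!: tendsto_eq_intros)
  then show ?case
  proof (rule Lim_null_comparison[rotated], intro always_eventually allI)
    fix h
    note [simp] = add.hyps[THEN integrable_lborel_translate] add.hyps
    have "(\<integral>x. \<bar>f (h + x) + g (h + x) - (f x + g x)\<bar> \<partial>lborel)
        \<le> (\<integral>x. \<bar>f (h + x) - f x\<bar> + \<bar>g (h + x) - g x\<bar> \<partial>lborel)"
      by (rule integral_mono) auto
    also have "\<dots> = (\<integral>x. \<bar>f (h + x) - f x\<bar> \<partial>lborel) + (\<integral>x. \<bar>g (h + x) - g x\<bar> \<partial>lborel)"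
      by (rule Bochner_Integration.integral_add) auto
    finally show "norm (\<integral>x. \<bar>f (h + x) + g (h + x) - (f x + g x)\<bar> \<partial>lborel)
        \<le> (\<integral>x. \<bar>f (h + x) - f x\<bar> \<partial>lborel) + (\<integral>x. \<bar>g (h + x) - g x\<bar> \<partial>lborel)"
      by simp
  qed
next
  case (lim f s)
  show ?case
  proof (rule tendsto_L1_translation_approx[OF lim.hyps(4)])
    fix e :: real assume "e > 0"
    note [measurable] = borel_measurable_integrable[OF lim.hyps(1)] borel_measurable_integrable[OF lim.hyps(4)]
    have "(\<lambda>i. \<integral>x. \<bar>f x - s i x\<bar> \<partial>lborel) \<longlonglongrightarrow> (\<integral>x. 0 \<partial>(lborel :: 'a measure))"
    proof (rule integral_dominated_convergence)
      \<comment> \<open>The induction rule supplies the bound 2 |f| for the approximants, so the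
        difference from \<open>f\<close> is at most 3 |f|.\<close>
      show "integrable lborel (\<lambda>x. 3 * \<bar>f x\<bar>)" using lim.hyps(4) by auto
      show "AE x in lborel. (\<lambda>i. \<bar>f x - s i x\<bar>) \<longlonglongrightarrow> 0"
        using lim.hyps(2) by (intro AE_I2) (auto intro!: tendsto_eq_intros)
      show "AE x in lborel. norm \<bar>f x - s i x\<bar> \<le> 3 * \<bar>f x\<bar>" for i
      proof (rule AE_I2)
        fix x show "norm \<bar>f x - s i x\<bar> \<le> 3 * \<bar>f x\<bar>"
          using lim.hyps(3)[of x i] by auto
      qed
    qed auto
    then have "eventually (\<lambda>i. (\<integral>x. \<bar>f x - s i x\<bar> \<partial>lborel) < e) sequentially"
      using \<open>e > 0\<close> by (intro order_tendstoD(2)) auto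
    then obtain i where "(\<integral>x. \<bar>f x - s i x\<bar> \<partial>lborel) < e"
      by (auto simp: eventually_sequentially)
    then show "\<exists>g. integrable lborel g \<and>
        ((\<lambda>h. \<integral>x. \<bar>g (h + x) - g x\<bar> \<partial>lborel) \<longlongrightarrow> 0) (at 0) \<and> (\<integral>x. \<bar>f x - g x\<bar> \<partial>lborel) < e"
      using lim.hyps(1) lim.IH by blast
  qed
qed

subsection \<open>Fourier positivity\<close>

lemma borel_measurable_cis [measurable]: "cis \<in> borel_measurable borel"
  by (intro borel_measurable_continuous_onI continuous_intros)

section \<open>The Gaussian and its Fourier transform\<close>

definition gaussian :: "'a::euclidean_space \<Rightarrow> real" where
  "gaussian x = (\<Prod>b\<in>Basis. std_normal_density (x \<bullet> b))"

lemma borel_measurable_gaussian [measurable]: "gaussian \<in> borel_measurable borel"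
  unfolding gaussian_def by measurable

lemma gaussian_pos: "gaussian x > 0"
  unfolding gaussian_def by (intro prod_pos) (auto simp: normal_density_pos)

text \<open>Density and character both factor over the coordinates, which reduces the claims to
  dimension one. There the characteristic function of the standard normal distribution is again a
  multiple of its density, so the Gaussian is an eigenfunction of the transform.\<close>

lemma
  fixes x :: "'a::euclidean_space"
  shows integrable_gaussian: "integrable lborel (gaussian :: 'a \<Rightarrow> real)" (is ?A)
    and fourier_gaussian: "(\<integral>\<xi>. complex_of_real (gaussian \<xi>) * cis (- (\<xi> \<bullet> x)) \<partial>lborel)
       = sqrt (2 * pi) ^ DIM('a) * gaussian x" (is ?B)
proof -
  interpret product_sigma_finite "\<lambda>_::'a. lborel :: real measure" ..
  have char1: "(\<integral>u. complex_of_real (std_normal_density u) * cis (- (u * s)) \<partial>lborel)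
      = sqrt (2 * pi) * std_normal_density s" for s
  proof -
    have "(\<integral>u. complex_of_real (std_normal_density u) * cis (- (u * s)) \<partial>lborel)
        = char std_normal_distribution (- s)"
      unfolding char_def
      by (subst integral_density)
         (auto simp: normal_density_nonneg scaleR_conv_of_real cis_conv_exp mult_ac intro!: Bochner_Integration.integral_cong)
    also have "\<dots> = exp (- (s\<^sup>2) / 2)"
      by (simp add: char_std_normal_distribution)
    also have "\<dots> = sqrt (2 * pi) * std_normal_density s"
      by (simp add: std_normal_density_def)
    finally show ?thesis .
  qed
  have int1: "integrable lborel (\<lambda>u. complex_of_real (std_normal_density u) * cis (- (u * s)))" for s
  proof -
    have "integrable lborel (\<lambda>u. complex_of_real (std_normal_density u))"
      by (simp add: integrable_normal_density)
    then show ?thesis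
      by (rule Bochner_Integration.integrable_bound) (auto simp: norm_mult)
  qed
  have cis_prod: "complex_of_real (gaussian \<xi>) * cis (- (\<xi> \<bullet> x))
      = (\<Prod>b\<in>Basis. complex_of_real (std_normal_density (\<xi> \<bullet> b)) * cis (- ((\<xi> \<bullet> b) * (x \<bullet> b))))"
    for \<xi> :: 'a
    unfolding gaussian_def prod.distrib of_real_prod
    by (subst euclidean_inner)
       (simp add: cis_conv_exp exp_sum sum_distrib_left flip: sum_negf)
  have "(\<integral>\<xi>. complex_of_real (gaussian \<xi>) * cis (- (\<xi> \<bullet> x)) \<partial>lborel)
     = (\<integral>f. (\<Prod>b\<in>Basis. complex_of_real (std_normal_density (f b)) * cis (- (f b * (x \<bullet> b))))
          \<partial>(\<Pi>\<^sub>M b\<in>(Basis::'a set). lborel))"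
    unfolding cis_prod
    by (subst lborel_eq, subst integral_distr) (auto intro!: Bochner_Integration.integral_cong prod.cong)
  also have "\<dots> = (\<Prod>b\<in>(Basis::'a set). \<integral>u. complex_of_real (std_normal_density u) * cis (- (u * (x \<bullet> b))) \<partial>lborel)"
    by (rule product_integral_prod) (auto intro: int1)
  also have "\<dots> = sqrt (2 * pi) ^ DIM('a) * gaussian x"
    by (simp add: char1 gaussian_def prod.distrib)
  finally show ?B .
  have "(\<integral>\<^sup>+x. ennreal (gaussian x) \<partial>(lborel :: 'a measure))
      = (\<integral>\<^sup>+x. (\<Prod>b\<in>Basis. ennreal (std_normal_density (x \<bullet> b))) \<partial>(lborel :: 'a measure))"
    unfolding gaussian_def by (simp add: prod_ennreal normal_density_nonneg)
  also have "\<dots> = (\<Prod>b\<in>(Basis::'a set). \<integral>\<^sup>+u. ennreal (std_normal_density u) \<partial>lborel)"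
    by (rule nn_integral_lborel_prod) auto
  also have "\<dots> = 1"
    by (simp add: nn_integral_eq_integral integrable_normal_density integral_normal_density normal_density_nonneg)
  finally show ?A
    by (intro integrableI_nonneg) (auto intro: less_imp_le gaussian_pos)
qed

text \<open>The integral is the transform at frequency 0, which is a positive multiple of the value
  of the Gaussian at 0.\<close>

lemma integral_gaussian_pos: "(\<integral>x. gaussian x \<partial>(lborel :: 'a::euclidean_space measure)) > 0"
proof -
  have "complex_of_real (\<integral>x. gaussian x \<partial>(lborel :: 'a measure)) = sqrt (2 * pi) ^ DIM('a) * gaussian (0::'a)"
    using fourier_gaussian[of "0::'a"] by simp
  then have "(\<integral>x. gaussian x \<partial>(lborel :: 'a measure)) = sqrt (2 * pi) ^ DIM('a) * gaussian (0::'a)"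
    by (metis of_real_eq_iff of_real_mult of_real_power)
  then show ?thesis
    by (simp add: gaussian_pos)
qed

text \<open>\<open>fourier\<close> integrates over the completed measure, while the Fubini arguments
  below run over products of \<open>lborel\<close>; for Borel functions the two integrals
  agree.\<close>

lemma fourier_lborel:
  fixes c :: "'a::euclidean_space \<Rightarrow> real"
  assumes [measurable]: "c \<in> borel_measurable borel"
  shows "fourier c \<xi> = (\<integral>x. complex_of_real (c x) * cis (- (\<xi> \<bullet> x)) \<partial>lborel)"
  unfolding fourier_def by (rule integral_completion) measurable

lemma integrable_lborel_pair_mult:
  fixes p :: "'a::euclidean_space \<Rightarrow> real" and q :: "'b::euclidean_space \<Rightarrow> real"
  assumes "integrable lborel p" "integrable lborel q"
  shows "integrable (lborel \<Otimes>\<^sub>M lborel) (\<lambda>(x, y). p x * q y)"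
proof -
  have [measurable]: "p \<in> borel_measurable borel" "q \<in> borel_measurable borel"
    using assms by auto
  show ?thesis
    using assms by (intro lborel_pair.Fubini_integrable) (auto simp: abs_mult)
qed

text \<open>By translation invariance the inner integral of |q (y - x)| does not depend on
  \<open>x\<close>, so Fubini's criterion comes down to integrability of \<open>p\<close>.\<close>

lemma integrable_lborel_pair_convolution:
  fixes p q :: "'a::euclidean_space \<Rightarrow> real"
  assumes p: "integrable lborel p" and q: "integrable lborel q"
  shows "integrable (lborel \<Otimes>\<^sub>M lborel) (\<lambda>(x, y). p x * q (y - x))"
proof -
  have [measurable]: "p \<in> borel_measurable borel" "q \<in> borel_measurable borel"
    using assms by auto
  have q': "integrable lborel (\<lambda>y. q (y - x))" for x
    using integrable_lborel_translate[OF q, of "- x"] by simp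
  have "(\<integral>y. \<bar>q (y - x)\<bar> \<partial>lborel) = (\<integral>y. \<bar>q y\<bar> \<partial>lborel)" for x
    using integral_lborel_translate[of "\<lambda>y. \<bar>q y\<bar>" "- x"] by simp
  then show ?thesis
    using p q' by (intro lborel_pair.Fubini_integrable) (auto simp: abs_mult)
qed

text \<open>The integral of \<open>c\<close> against a Gaussian of width \<open>t\<close> equals, up
  to a positive factor, an integral of the transform of \<open>c\<close> against a Gaussian, hence
  is nonnegative. As \<open>t\<close> tends to 0 the rescaled integrals converge to
  \<open>c 0\<close> times the positive mass of the Gaussian.\<close>

lemma nonneg_at_0_if_fourier_nonneg:
  fixes c :: "'a::euclidean_space \<Rightarrow> real"
  assumes c: "integrable lborel c" and bound: "\<And>x. \<bar>c x\<bar> \<le> B" and cont: "isCont c 0"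
    and nonneg: "\<And>\<xi>. 0 \<le> Re (fourier c \<xi>)"
  shows "0 \<le> c 0"
proof -
  have [measurable]: "c \<in> borel_measurable borel" using c by auto
  define g where "g = (gaussian :: 'a \<Rightarrow> real)"
  have g: "integrable lborel g" and [measurable]: "g \<in> borel_measurable borel" and g_pos: "g x > 0" for x
    by (auto simp: g_def integrable_gaussian gaussian_pos)
  have scaled: "0 \<le> (\<integral>x. c (t *\<^sub>R x) * g x \<partial>lborel)" if "t > 0" for t
  proof -
    \<comment> \<open>Integrated over \<xi> first, \<open>H\<close> gives \<open>c\<close> times a
      Gaussian of width \<open>t\<close>; integrated over \<open>x\<close> first, it gives the
      Gaussian times the transform of \<open>c\<close> at \<xi>/t.\<close>
    define H where "H = (\<lambda>(x, \<xi>). complex_of_real (c x * g \<xi>) * cis (- (\<xi> \<bullet> x) / t))"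
    have H: "integrable (lborel \<Otimes>\<^sub>M lborel) H"
      unfolding H_def
      by (rule Bochner_Integration.integrable_bound[OF integrable_lborel_pair_mult[OF c g]])
         (auto simp: norm_mult abs_mult split_beta)
    have "(\<integral>x. complex_of_real (sqrt (2 * pi) ^ DIM('a) * (c x * g (x /\<^sub>R t))) \<partial>lborel)
        = (\<integral>x. (\<integral>\<xi>. H (x, \<xi>) \<partial>lborel) \<partial>lborel)"
    proof (rule Bochner_Integration.integral_cong[OF refl])
      fix x :: 'a
      have "(\<integral>\<xi>. H (x, \<xi>) \<partial>lborel)
          = (\<integral>\<xi>. complex_of_real (c x) * (complex_of_real (g \<xi>) * cis (- (\<xi> \<bullet> (x /\<^sub>R t)))) \<partial>lborel)"
        by (intro Bochner_Integration.integral_cong) (auto simp: H_def divide_inverse mult_ac)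
      also have "\<dots> = complex_of_real (c x) * (sqrt (2 * pi) ^ DIM('a) * g (x /\<^sub>R t))"
        by (simp only: integral_mult_right_zero g_def fourier_gaussian)
      finally show "complex_of_real (sqrt (2 * pi) ^ DIM('a) * (c x * g (x /\<^sub>R t))) = (\<integral>\<xi>. H (x, \<xi>) \<partial>lborel)"
        by simp
    qed
    also have "\<dots> = (\<integral>\<xi>. (\<integral>x. H (x, \<xi>) \<partial>lborel) \<partial>lborel)"
      using lborel_pair.Fubini_integral[of "\<lambda>x \<xi>. H (x, \<xi>)"] H by simp
    also have "\<dots> = (\<integral>\<xi>. complex_of_real (g \<xi>) * fourier c (\<xi> /\<^sub>R t) \<partial>lborel)"
    proof (rule Bochner_Integration.integral_cong[OF refl])
      fix \<xi> :: 'a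
      have "(\<integral>x. H (x, \<xi>) \<partial>lborel)
          = (\<integral>x. complex_of_real (g \<xi>) * (complex_of_real (c x) * cis (- ((\<xi> /\<^sub>R t) \<bullet> x))) \<partial>lborel)"
        by (intro Bochner_Integration.integral_cong) (auto simp: H_def divide_inverse mult_ac)
      then show "(\<integral>x. H (x, \<xi>) \<partial>lborel) = complex_of_real (g \<xi>) * fourier c (\<xi> /\<^sub>R t)"
        by (simp add: fourier_lborel)
    qed
    finally have eq: "(\<integral>x. complex_of_real (sqrt (2 * pi) ^ DIM('a) * (c x * g (x /\<^sub>R t))) \<partial>lborel)
        = (\<integral>\<xi>. complex_of_real (g \<xi>) * fourier c (\<xi> /\<^sub>R t) \<partial>lborel)" .
    have "0 \<le> Re (\<integral>\<xi>. complex_of_real (g \<xi>) * fourier c (\<xi> /\<^sub>R t) \<partial>lborel)"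
    \<comment> \<open>A non-integrable function has Bochner integral 0 by convention, so the other
      case is trivial.\<close>
    proof (cases "integrable lborel (\<lambda>\<xi>. complex_of_real (g \<xi>) * fourier c (\<xi> /\<^sub>R t))")
      case True
      then have "Re (\<integral>\<xi>. complex_of_real (g \<xi>) * fourier c (\<xi> /\<^sub>R t) \<partial>lborel)
          = (\<integral>\<xi>. g \<xi> * Re (fourier c (\<xi> /\<^sub>R t)) \<partial>lborel)"
        by (subst integral_Re[symmetric]) auto
      also have "\<dots> \<ge> 0"
        using nonneg g_pos by (intro Bochner_Integration.integral_nonneg) (auto intro: mult_nonneg_nonneg less_imp_le)
      finally show ?thesis .
    qed (simp add: not_integrable_integral_eq)
    then have "0 \<le> (\<integral>x. sqrt (2 * pi) ^ DIM('a) * (c x * g (x /\<^sub>R t)) \<partial>lborel)"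
      unfolding eq[symmetric] integral_complex_of_real by simp
    then have "0 \<le> (\<integral>x. c x * g (x /\<^sub>R t) \<partial>lborel)"
      using mult_le_cancel_left_pos[of "sqrt (2 * pi) ^ DIM('a)" 0] by simp
    \<comment> \<open>The substitution x -> t x moves the scale from the Gaussian to
      \<open>c\<close>, where dominated convergence can use the continuity of \<open>c\<close> at
      0.\<close>
    then show ?thesis
      using that mult_le_cancel_left_pos[of "t ^ DIM('a)" 0]
      by (subst (asm) integral_lborel_affine[of _ t 0]) auto
  qed
  have "(\<lambda>i. \<integral>x. c (inverse (real (Suc i)) *\<^sub>R x) * g x \<partial>lborel) \<longlonglongrightarrow> (\<integral>x. c 0 * g x \<partial>lborel)"
  proof (rule integral_dominated_convergence[where w = "\<lambda>x. B * g x"])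
    show "AE x in lborel. (\<lambda>i. c (inverse (real (Suc i)) *\<^sub>R x) * g x) \<longlonglongrightarrow> c 0 * g x"
    proof (rule AE_I2)
      fix x :: 'a
      have "(\<lambda>i. inverse (real (Suc i)) *\<^sub>R x) \<longlonglongrightarrow> 0 *\<^sub>R x"
        by (intro tendsto_scaleR tendsto_const LIMSEQ_inverse_real_of_nat)
      then have "(\<lambda>i. c (inverse (real (Suc i)) *\<^sub>R x)) \<longlonglongrightarrow> c 0"
        by (intro isCont_tendsto_compose[OF cont]) simp
      then show "(\<lambda>i. c (inverse (real (Suc i)) *\<^sub>R x) * g x) \<longlonglongrightarrow> c 0 * g x"
        by (intro tendsto_intros)
    qed
    show "AE x in lborel. norm (c (inverse (real (Suc i)) *\<^sub>R x) * g x) \<le> B * g x" for i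
      using bound g_pos by (intro AE_I2) (auto simp: abs_mult abs_of_pos intro!: mult_right_mono less_imp_le)
  qed (use g in auto)
  then have "0 \<le> (\<integral>x. c 0 * g x \<partial>lborel)"
    by (rule LIMSEQ_le_const) (auto intro!: scaled)
  then show "0 \<le> c 0"
    using integral_gaussian_pos[where 'a='a] by (simp add: g_def zero_le_mult_iff)
qed

section \<open>Convolution, autocorrelation and positive semidefiniteness\<close>

definition fconvolution :: "('a::euclidean_space \<Rightarrow> real) \<Rightarrow> ('a \<Rightarrow> real) \<Rightarrow> 'a \<Rightarrow> real" where
  "fconvolution p q x = (\<integral>y. p y * q (x - y) \<partial>lborel)"

lemma integrable_convolution:
  assumes "integrable lborel p" "integrable lborel q"
  shows "integrable lborel (fconvolution p q)"
  using lborel_pair.integrable_snd[of "\<lambda>x y. p x * q (y - x)"] integrable_lborel_pair_convolution[OF assms]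
  by (simp add: fconvolution_def[abs_def])

text \<open>Interchange the integrals and shift \<open>x\<close> by \<open>y\<close>: the character
  of y + x is a product, so the inner integral factors.\<close>

lemma fourier_convolution:
  fixes p q :: "'a::euclidean_space \<Rightarrow> real"
  assumes p: "integrable lborel p" and q: "integrable lborel q"
  shows "fourier (fconvolution p q) \<xi> = fourier p \<xi> * fourier q \<xi>"
proof -
  have [measurable]: "p \<in> borel_measurable borel" "q \<in> borel_measurable borel"
      "fconvolution p q \<in> borel_measurable borel"
    using assms integrable_convolution[OF assms] by auto
  define H where "H = (\<lambda>(y, x). complex_of_real (p y * q (x - y)) * cis (- (\<xi> \<bullet> x)))"
  have H: "integrable (lborel \<Otimes>\<^sub>M lborel) H"
    unfolding H_def
    by (rule Bochner_Integration.integrable_bound[OF integrable_lborel_pair_convolution[OF p q]])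
       (auto simp: norm_mult abs_mult split_beta)
  have "fourier (fconvolution p q) \<xi> = (\<integral>x. (\<integral>y. H (y, x) \<partial>lborel) \<partial>lborel)"
    unfolding H_def by (simp add: fourier_lborel fconvolution_def flip: integral_complex_of_real)
  also have "\<dots> = (\<integral>y. (\<integral>x. H (y, x) \<partial>lborel) \<partial>lborel)"
    using lborel_pair.Fubini_integral[of "\<lambda>y x. H (y, x)"] H by simp
  also have "\<dots> = (\<integral>y. complex_of_real (p y) * cis (- (\<xi> \<bullet> y)) * fourier q \<xi> \<partial>lborel)"
  proof (rule Bochner_Integration.integral_cong[OF refl])
    fix y
    have "(\<integral>x. H (y, x) \<partial>lborel) = (\<integral>x. H (y, y + x) \<partial>lborel)"
      by (rule integral_lborel_translate) (simp add: H_def)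
    also have "\<dots> = (\<integral>x. (complex_of_real (p y) * cis (- (\<xi> \<bullet> y))) * (complex_of_real (q x) * cis (- (\<xi> \<bullet> x))) \<partial>lborel)"
      by (rule Bochner_Integration.integral_cong) (auto simp: H_def inner_add_right cis_mult algebra_simps)
    also have "\<dots> = complex_of_real (p y) * cis (- (\<xi> \<bullet> y)) * fourier q \<xi>"
      by (subst integral_mult_right_zero) (simp add: fourier_lborel)
    finally show "(\<integral>x. H (y, x) \<partial>lborel) = complex_of_real (p y) * cis (- (\<xi> \<bullet> y)) * fourier q \<xi>" .
  qed
  also have "\<dots> = fourier p \<xi> * fourier q \<xi>"
    by (subst integral_mult_left_zero) (simp add: fourier_lborel)
  finally show ?thesis .
qed

text \<open>Since \<open>w\<close> is real, reflecting it has the same effect as conjugating the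
  character.\<close>

lemma fourier_reflect:
  fixes w :: "'a::euclidean_space \<Rightarrow> real"
  assumes w: "integrable lborel w"
  shows "fourier (\<lambda>x. w (- x)) \<xi> = cnj (fourier w \<xi>)"
proof -
  have [measurable]: "w \<in> borel_measurable borel" using w by auto
  have "fourier (\<lambda>x. w (- x)) \<xi> = (\<integral>x. complex_of_real (w x) * cis (\<xi> \<bullet> x) \<partial>lborel)"
    by (simp add: fourier_lborel)
       (subst integral_lborel_reflect[of "\<lambda>x. complex_of_real (w (- x)) * cis (- (\<xi> \<bullet> x))" 0], auto)
  also have "\<dots> = (\<integral>x. cnj (complex_of_real (w x) * cis (- (\<xi> \<bullet> x))) \<partial>lborel)"
    by (simp add: cis_cnj)
  also have "\<dots> = cnj (fourier w \<xi>)"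
    by (subst Bochner_Integration.integral_cnj) (simp add: fourier_lborel)
  finally show ?thesis .
qed

text \<open>An increment by \<open>h\<close> is at most \<open>B\<close> times the L1 distance
  between \<open>w\<close> and its translate by \<open>- h\<close>, so continuity of translation in
  L1 suffices and \<open>w\<close> may be a difference of indicators.\<close>

lemma isCont_autocorrelation:
  fixes w :: "'a::euclidean_space \<Rightarrow> real"
  assumes w: "integrable lborel w" and bound: "\<And>x. \<bar>w x\<bar> \<le> B"
  shows "isCont (fconvolution w (\<lambda>x. w (- x))) s"
proof -
  have [measurable]: "w \<in> borel_measurable borel" using w by auto
  have shift: "integrable lborel (\<lambda>x. w (x - s))" for s
    using integrable_lborel_translate[OF w, of "- s"] by simp
  have int: "integrable lborel (\<lambda>x. w x * w (x - s))" for s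
    by (rule Bochner_Integration.integrable_bound[of _ "\<lambda>x. B * w (x - s)"])
       (use shift bound in \<open>auto simp: abs_mult intro!: mult_right_mono order_trans[OF bound abs_ge_self]\<close>)
  let ?f = "fconvolution w (\<lambda>x. w (- x))"
  have diff: "norm (?f (s + h) - ?f s) \<le> B * (\<integral>x. \<bar>w (- h + x) - w x\<bar> \<partial>lborel)" for h
  proof -
    have int_diff: "integrable lborel (\<lambda>x. w x * (w (x - (s + h)) - w (x - s)))"
      using int by (simp add: right_diff_distrib)
    have "?f (s + h) - ?f s = (\<integral>x. w x * (w (x - (s + h)) - w (x - s)) \<partial>lborel)"
      by (simp add: fconvolution_def int right_diff_distrib)
    also have "norm \<dots> \<le> (\<integral>x. B * \<bar>w (x - (s + h)) - w (x - s)\<bar> \<partial>lborel)"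
      by (rule order_trans[OF integral_norm_bound], rule integral_mono, rule integrable_norm[OF int_diff])
         (use shift bound in \<open>auto simp: abs_mult intro!: mult_right_mono\<close>)
    also have "\<dots> = B * (\<integral>x. \<bar>w (x - (s + h)) - w (x - s)\<bar> \<partial>lborel)" by simp
    also have "(\<integral>x. \<bar>w (x - (s + h)) - w (x - s)\<bar> \<partial>lborel) = (\<integral>x. \<bar>w (- h + x) - w x\<bar> \<partial>lborel)"
      using integral_lborel_translate[of "\<lambda>x. \<bar>w (x - (s + h)) - w (x - s)\<bar>" s]
      by (simp add: algebra_simps)
    finally show ?thesis .
  qed
  have "filterlim (\<lambda>h::'a. - h) (at 0) (at 0)"
    by (rule filterlim_atI) (auto intro!: tendsto_eq_intros simp: eventually_at_filter)
  from tendsto_compose_filtermap tendsto_L1_translation[OF w, THEN filterlim_compose, OF this]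
  have "((\<lambda>h. B * (\<integral>x. \<bar>w (- h + x) - w x\<bar> \<partial>lborel)) \<longlongrightarrow> 0) (at 0)"
    by (auto intro!: tendsto_eq_intros)
  then have "((\<lambda>h. ?f (s + h) - ?f s) \<longlongrightarrow> 0) (at 0)"
    by (rule Lim_null_comparison[rotated]) (intro always_eventually allI diff)
  then show ?thesis
    by (simp add: isCont_def LIM_offset_zero_iff[of s] LIM_zero_iff)
qed

text \<open>The double integral is the value at 0 of \<open>J\<close> convolved with the
  autocorrelation \<open>f\<close> of \<open>w\<close>. The transform of \<open>f\<close> is the
  squared modulus of that of \<open>w\<close>, so the transform of the convolution is nonnegative.
  Boundedness and continuity of the convolution come from \<open>f\<close>, since \<open>J\<close>
  is only integrable.\<close>

theorem fourier_nonneg_imp_positive_semidefinite: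
  fixes J w :: "'a::euclidean_space \<Rightarrow> real"
  assumes J: "integrable lborel J" and J_fourier: "\<And>\<xi>. fourier J \<xi> \<in> \<real>\<^sub>\<ge>\<^sub>0"
    and w: "integrable lborel w" and bound: "\<And>x. \<bar>w x\<bar> \<le> B"
  shows "0 \<le> (\<integral>x. (\<integral>y. J (y - x) * w x * w y \<partial>lborel) \<partial>lborel)"
proof -
  have [measurable]: "w \<in> borel_measurable borel" "J \<in> borel_measurable borel"
    using w J by auto
  define f where "f = fconvolution w (\<lambda>x. w (- x))"
  have w': "integrable lborel (\<lambda>x. w (- x))"
    using integrable_lborel_reflect[OF w, of 0] by simp
  have f: "integrable lborel f"
    unfolding f_def by (rule integrable_convolution[OF w w'])
  then have [measurable]: "f \<in> borel_measurable borel" by auto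
  have f_bound: "\<bar>f x\<bar> \<le> B * (\<integral>x. \<bar>w x\<bar> \<partial>lborel)" for x
  proof -
    have "\<bar>f x\<bar> \<le> (\<integral>y. \<bar>w y * w (- (x - y))\<bar> \<partial>lborel)"
      unfolding f_def fconvolution_def by (rule integral_abs_bound)
    also have "\<dots> \<le> (\<integral>y. B * \<bar>w y\<bar> \<partial>lborel)"
      by (rule integral_mono')
         (use w bound in \<open>auto simp: abs_mult mult.commute[of B] intro!: mult_left_mono mult_nonneg_nonneg order_trans[OF abs_ge_zero bound]\<close>)
    finally show ?thesis by simp
  qed
  have f_cont: "isCont f x" for x
    unfolding f_def by (rule isCont_autocorrelation[OF w bound])
  have "0 \<le> fconvolution J f 0"
  proof (rule nonneg_at_0_if_fourier_nonneg)
    show "integrable lborel (fconvolution J f)"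
      by (rule integrable_convolution[OF J f])
    show "\<bar>fconvolution J f x\<bar> \<le> (\<integral>y. \<bar>J y\<bar> * (B * (\<integral>x. \<bar>w x\<bar> \<partial>lborel)) \<partial>lborel)" for x
      unfolding fconvolution_def
      by (rule order_trans[OF integral_abs_bound], rule integral_mono')
         (use J f_bound in \<open>auto simp: abs_mult intro!: mult_left_mono mult_nonneg_nonneg order_trans[OF abs_ge_zero f_bound]\<close>)
    show "isCont (fconvolution J f) 0"
      unfolding isCont_def fconvolution_def
    proof (rule integral_dominated_convergence_at)
      show "integrable lborel (\<lambda>y. \<bar>J y\<bar> * (B * (\<integral>x. \<bar>w x\<bar> \<partial>lborel)))"
        using J by auto
      show "AE y in lborel. ((\<lambda>h. J y * f (h - y)) \<longlongrightarrow> J y * f (0 - y)) (at 0)"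
        by (intro AE_I2 tendsto_intros isCont_tendsto_compose[OF f_cont])
    qed (use f_bound in \<open>auto simp: abs_mult intro!: mult_left_mono\<close>)
    show "0 \<le> Re (fourier (fconvolution J f) \<xi>)" for \<xi>
    proof -
      have "fourier f \<xi> = fourier w \<xi> * cnj (fourier w \<xi>)"
        unfolding f_def by (simp add: fourier_convolution[OF w w'] fourier_reflect[OF w])
      also have "\<dots> = complex_of_real ((cmod (fourier w \<xi>))\<^sup>2)"
        by (rule complex_norm_square[symmetric])
      finally have "fourier f \<xi> = complex_of_real ((cmod (fourier w \<xi>))\<^sup>2)" .
      with J_fourier[of \<xi>] show ?thesis
        by (auto simp: fourier_convolution[OF J f] complex_nonneg_Reals_iff)
    qed
  qed
  \<comment> \<open>Here \<open>f\<close> is evaluated at \<open>- v\<close>, where the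
    autocorrelation is the integral of \<open>w x * w (x + v)\<close>. The substitution y = x + v
    below then restores the form of the claim.\<close>
  also have "fconvolution J f 0 = (\<integral>v. (\<integral>x. J v * w x * w (x + v) \<partial>lborel) \<partial>lborel)"
    by (simp add: fconvolution_def f_def mult.assoc add.commute)
  also have "\<dots> = (\<integral>x. (\<integral>v. J v * w x * w (x + v) \<partial>lborel) \<partial>lborel)"
  proof (rule lborel_pair.Fubini_integral)
    show "integrable (lborel \<Otimes>\<^sub>M lborel) (\<lambda>(x, v). J v * w x * w (x + v))"
    proof (rule Bochner_Integration.integrable_bound[OF integrable_mult_left[OF integrable_lborel_pair_mult[OF w J], of B]])
      have "\<bar>J v * w x\<bar> * \<bar>w (x + v)\<bar> \<le> \<bar>J v * w x\<bar> * \<bar>B\<bar>" for x v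
        by (intro mult_left_mono order_trans[OF bound abs_ge_self]) auto
      then show "AE p in lborel \<Otimes>\<^sub>M lborel. norm (case p of (x, v) \<Rightarrow> J v * w x * w (x + v))
          \<le> norm ((case p of (x, v) \<Rightarrow> w x * J v) * B)"
        by (auto simp: split_beta abs_mult mult_ac)
    qed measurable
  qed
  also have "\<dots> = (\<integral>x. (\<integral>y. J (y - x) * w x * w y \<partial>lborel) \<partial>lborel)"
  proof (rule Bochner_Integration.integral_cong[OF refl])
    fix x
    show "(\<integral>v. J v * w x * w (x + v) \<partial>lborel) = (\<integral>y. J (y - x) * w x * w y \<partial>lborel)"
      by (subst (2) integral_lborel_translate[of _ x]) auto
  qed
  finally show ?thesis .
qed

subsection \<open>Threshold dynamics\<close>

text \<open>The nonnegative integral over a completion agrees with that over the original measure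
  for every integrand, so this covers kernels that are only Lebesgue measurable.\<close>

lemma nonlocal_energy_lborel:
  "nonlocal_energy L \<phi> = (\<integral>\<^sup>+y. (\<integral>\<^sup>+x. ennreal (L (x - y) * \<bar>\<phi> x - \<phi> y\<bar>) \<partial>lborel) \<partial>lborel)"
  by (simp add: nonlocal_energy_def nn_integral_completion)

lemma nonlocal_energy_pair:
  fixes J \<phi> :: "'a::euclidean_space \<Rightarrow> real"
  assumes [measurable]: "J \<in> borel_measurable borel" "\<phi> \<in> borel_measurable borel"
  shows "nonlocal_energy J \<phi>
    = (\<integral>\<^sup>+p. ennreal (case p of (x, y) \<Rightarrow> J (x - y) * \<bar>\<phi> x - \<phi> y\<bar>) \<partial>(lborel \<Otimes>\<^sub>M lborel))"
  unfolding nonlocal_energy_lborel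
  using lborel_pair.nn_integral_snd[of "\<lambda>(x, y). ennreal (J (x - y) * \<bar>\<phi> x - \<phi> y\<bar>)"]
  by (simp add: case_prod_unfold)

section \<open>Thresholding of sets for a Borel kernel\<close>

locale median_kernel =
  fixes J :: "'a::euclidean_space \<Rightarrow> real"
  assumes integrable_kernel: "integrable lborel J"
    and kernel_nonneg: "J x \<ge> 0"
    and kernel_even: "J (- x) = J x"
    and kernel_mass: "(\<integral>x. J x \<partial>lborel) = 1"
    and kernel_fourier: "fourier J \<xi> \<in> \<real>\<^sub>\<ge>\<^sub>0"
begin

lemma kernel_measurable [measurable]: "J \<in> borel_measurable borel"
  using integrable_kernel by auto

lemma kernel_minus: "J (x - y) = J (y - x)"
  using kernel_even[of "x - y"] by simp

lemma integrable_kernel_shift: "integrable lborel (\<lambda>y. J (x - y))"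
  by (rule integrable_lborel_reflect[OF integrable_kernel])

lemma integral_kernel_shift: "(\<integral>y. J (x - y) \<partial>lborel) = 1"
  using integral_lborel_reflect[of J x] kernel_mass by simp

text \<open>This is the convolution of \<open>J\<close> with the indicator of \<open>T\<close>. For
  a superlevel set it is the weight whose comparison with 1/2 defines the median.\<close>

definition smear :: "'a set \<Rightarrow> 'a \<Rightarrow> real" where
  "smear T x = (\<integral>y. indicat_real T y * J (x - y) \<partial>lborel)"

lemma integrable_smear:
  assumes [measurable]: "T \<in> sets borel"
  shows "integrable lborel (\<lambda>y. indicat_real T y * J (x - y))"
  by (rule Bochner_Integration.integrable_bound[OF integrable_kernel_shift[of x]])
     (auto simp: indicator_def)

lemma smear_measurable [measurable]:
  assumes [measurable]: "T \<in> sets borel"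
  shows "smear T \<in> borel_measurable borel"
  unfolding smear_def[abs_def] by measurable

lemma smear_mono:
  assumes "S \<subseteq> T" "S \<in> sets borel" "T \<in> sets borel"
  shows "smear S x \<le> smear T x"
  unfolding smear_def
  by (intro integral_mono integrable_smear assms mult_right_mono kernel_nonneg)
     (use assms in \<open>auto simp: indicator_def\<close>)

lemma smear_UNIV: "smear UNIV x = 1"
  by (simp add: smear_def integral_kernel_shift)

lemma smear_empty: "smear {} x = 0"
  by (simp add: smear_def)

lemma smear_nonneg: "T \<in> sets borel \<Longrightarrow> 0 \<le> smear T x"
  using smear_mono[of "{}" T x] by (simp add: smear_empty)

lemma smear_le_1: "T \<in> sets borel \<Longrightarrow> smear T x \<le> 1"
  using smear_mono[of T UNIV x] by (simp add: smear_UNIV)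

text \<open>Seen from a point of \<open>T\<close> the oscillation is the indicator of the
  complement, seen from elsewhere it is that of \<open>T\<close>: the integral is the kernel weight
  of the opposite side.\<close>

lemma integral_oscillation:
  assumes [measurable]: "T \<in> sets borel"
  shows "(\<integral>y. J (x - y) * \<bar>indicat_real T x - indicat_real T y\<bar> \<partial>lborel)
    = (if x \<in> T then 1 - smear T x else smear T x)"
proof (cases "x \<in> T")
  case True
  then have "(\<integral>y. J (x - y) * \<bar>indicat_real T x - indicat_real T y\<bar> \<partial>lborel)
      = (\<integral>y. J (x - y) - indicat_real T y * J (x - y) \<partial>lborel)"
    by (intro Bochner_Integration.integral_cong) (auto simp: indicator_def)
  with True show ?thesis
    by (simp add: smear_def integrable_smear integrable_kernel_shift integral_kernel_shift)
next
  case False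
  then have "(\<integral>y. J (x - y) * \<bar>indicat_real T x - indicat_real T y\<bar> \<partial>lborel)
      = (\<integral>y. indicat_real T y * J (x - y) \<partial>lborel)"
    by (intro Bochner_Integration.integral_cong) (auto simp: indicator_def)
  with False show ?thesis
    by (simp add: smear_def)
qed

lemma threshold_dissipates:
  assumes T [measurable]: "T \<in> sets borel"
  defines "T' \<equiv> {x. 1 / 2 \<le> smear T x}"
  shows "nonlocal_energy J (indicat_real T') \<le> nonlocal_energy J (indicat_real T)"
proof (cases "nonlocal_energy J (indicat_real T) < \<infinity>")
  case True
  let ?M = "lborel \<Otimes>\<^sub>M lborel :: ('a \<times> 'a) measure"
  have T' [measurable]: "T' \<in> sets borel"
    unfolding T'_def by measurable
  define u u' w where "u = indicat_real T" and "u' = indicat_real T'" and "w = (\<lambda>x. u' x - u x)"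
  have [measurable]: "u \<in> borel_measurable borel" "u' \<in> borel_measurable borel" "w \<in> borel_measurable borel"
    unfolding w_def by (auto simp: u_def u'_def)
  define e e' where "e = (\<lambda>(x, y). J (x - y) * \<bar>u x - u y\<bar>)" and "e' = (\<lambda>(x, y). J (x - y) * \<bar>u' x - u' y\<bar>)"
  have e_nonneg: "e p \<ge> 0" "e' p \<ge> 0" for p
    using kernel_nonneg by (auto simp: e_def e'_def split_beta)
  have energy: "nonlocal_energy J u = (\<integral>\<^sup>+p. ennreal (e p) \<partial>?M)" "nonlocal_energy J u' = (\<integral>\<^sup>+p. ennreal (e' p) \<partial>?M)"
    by (auto simp: nonlocal_energy_pair e_def e'_def)
  have e: "integrable ?M e"
  proof (rule integrableI_nonneg)
    show "e \<in> borel_measurable ?M" unfolding e_def by measurable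
    show "(\<integral>\<^sup>+p. ennreal (e p) \<partial>?M) < \<infinity>" using True energy by (simp add: u_def)
  qed (simp add: e_nonneg)
  have w: "integrable lborel w"
  proof (rule Bochner_Integration.integrable_bound)
    show "integrable lborel (\<lambda>x. 2 * (\<integral>y. e (x, y) \<partial>lborel))"
      using lborel_pair.integrable_fst[of "\<lambda>x y. e (x, y)"] e by simp
    \<comment> \<open>A point where \<open>w\<close> is nonzero has changed sides, so the opposite
      side of \<open>T\<close> had weight at least 1/2 there.\<close>
    have "\<bar>w x\<bar> \<le> 2 * (\<integral>y. e (x, y) \<partial>lborel)" for x
      using integral_oscillation[OF T, of x] smear_nonneg[OF T, of x] smear_le_1[OF T, of x]
      by (auto simp: e_def u_def w_def u'_def T'_def indicator_def)
    then show "AE x in lborel. norm (w x) \<le> norm (2 * (\<integral>y. e (x, y) \<partial>lborel))"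
      by (intro AE_I2) (metis abs_ge_self order_trans real_norm_def)
  qed simp
  \<comment> \<open>\<open>a\<close> is the part of the energy change linear in \<open>w\<close>,
    \<open>p\<close> the quadratic part. Both are dominated by |w x| J (y - x), because |1 - 2 u| =
    1 and |w| \<le> 1.\<close>
  define a where "a = (\<lambda>(x, y). J (x - y) * w x * (1 - 2 * u y))"
  define p where "p = (\<lambda>(x, y). J (y - x) * w x * w y)"
  have J_w: "integrable ?M (\<lambda>(x, y). w x * J (y - x))"
    by (rule integrable_lborel_pair_convolution[OF w integrable_kernel])
  have a: "integrable ?M a"
    unfolding a_def
    by (rule Bochner_Integration.integrable_bound[OF J_w])
       (auto simp: split_beta abs_mult u_def indicator_def kernel_minus mult_ac)
  \<comment> \<open>The two linear terms are mirror images of each other and have equal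
    integrals.\<close>
  have a_swap: "integrable ?M (\<lambda>(x, y). a (y, x))" "(\<integral>p. (case p of (x, y) \<Rightarrow> a (y, x)) \<partial>?M) = (\<integral>p. a p \<partial>?M)"
    using lborel_pair.integrable_product_swap[OF a] lborel_pair.integral_product_swap[of a] a by auto
  have p: "integrable ?M p"
    unfolding p_def
    by (rule Bochner_Integration.integrable_bound[OF J_w])
       (auto simp: split_beta abs_mult w_def u_def u'_def indicator_def mult_ac)
  have "(\<integral>p. a p \<partial>?M) = (\<integral>x. (\<integral>y. a (x, y) \<partial>lborel) \<partial>lborel)"
    using lborel_pair.integral_fst'[OF a] by simp
  also have "\<dots> \<le> (\<integral>x. 0 \<partial>(lborel :: 'a measure))"
  proof (rule integral_mono')
    fix x
    have "(\<integral>y. a (x, y) \<partial>lborel) = (\<integral>y. w x * (J (x - y) - 2 * (indicat_real T y * J (x - y))) \<partial>lborel)"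
      by (rule Bochner_Integration.integral_cong) (auto simp: a_def u_def algebra_simps)
    also have "\<dots> = w x * (1 - 2 * smear T x)"
      by (simp add: smear_def integrable_smear integrable_kernel_shift integral_kernel_shift)
    \<comment> \<open>This is where the threshold enters: \<open>w x\<close> is 1 only if
      \<open>smear T x\<close> is at least 1/2, and -1 only if it is below 1/2.\<close>
    also have "\<dots> \<le> 0"
      by (auto simp: w_def u_def u'_def T'_def indicator_def)
    finally show "(\<integral>y. a (x, y) \<partial>lborel) \<le> 0" .
  qed simp_all
  finally have a_le: "(\<integral>p. a p \<partial>?M) \<le> 0" by simp
  have "(\<integral>q. p q \<partial>?M) = (\<integral>x. (\<integral>y. J (y - x) * w x * w y \<partial>lborel) \<partial>lborel)"
    using lborel_pair.integral_fst'[OF p] by (simp add: p_def)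
  also have "\<dots> \<ge> 0"
    by (rule fourier_nonneg_imp_positive_semidefinite[OF integrable_kernel kernel_fourier w, where B = 1])
       (auto simp: w_def u_def u'_def indicator_def)
  finally have p_ge: "(\<integral>q. p q \<partial>?M) \<ge> 0" .
  have split: "e' = (\<lambda>q. e q + a q + (case q of (x, y) \<Rightarrow> a (y, x)) - 2 * p q)"
  proof
    fix q :: "'a \<times> 'a"
    obtain x y where q: "q = (x, y)" by (cases q)
    \<comment> \<open>For s and t in {0, 1} one has |s - t| = s + t - 2 s t; substitute u' = u + w
      and expand.\<close>
    have "\<bar>u' x - u' y\<bar> = \<bar>u x - u y\<bar> + w x * (1 - 2 * u y) + w y * (1 - 2 * u x) - 2 * (w x * w y)"
      by (auto simp: w_def u_def u'_def indicator_def)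
    then have "e' q = J (x - y) * (\<bar>u x - u y\<bar> + w x * (1 - 2 * u y) + w y * (1 - 2 * u x) - 2 * (w x * w y))"
      by (simp add: e'_def q)
    then show "e' q = e q + a q + (case q of (x, y) \<Rightarrow> a (y, x)) - 2 * p q"
      by (simp add: q e_def a_def p_def kernel_minus[of y x] algebra_simps)
  qed
  have e': "integrable ?M e'"
    unfolding split using e a a_swap(1) p by (intro Bochner_Integration.integrable_add Bochner_Integration.integrable_diff) auto
  have "(\<integral>q. e' q \<partial>?M) = (\<integral>q. e q \<partial>?M) + 2 * (\<integral>q. a q \<partial>?M) - 2 * (\<integral>q. p q \<partial>?M)"
    unfolding split using e a a_swap p by simp
  then have "(\<integral>q. e' q \<partial>?M) \<le> (\<integral>q. e q \<partial>?M)"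
    using a_le p_ge by simp
  then have "nonlocal_energy J u' \<le> nonlocal_energy J u"
    unfolding energy using e e' e_nonneg by (simp add: nn_integral_eq_integral ennreal_leI)
  then show ?thesis by (simp add: u_def u'_def)
qed (simp add: not_less top_unique)

section \<open>From sets to functions: layer cake formula and weighted median\<close>

lemma nonlocal_energy_layer_cake:
  assumes [measurable]: "\<phi> \<in> borel_measurable borel"
  shows "nonlocal_energy J \<phi> = (\<integral>\<^sup>+c. nonlocal_energy J (indicat_real (superlevel c \<phi>)) \<partial>lborel)"
proof -
  \<comment> \<open>The indicator of the superlevel set as an explicit condition on the pair of
    \<open>c\<close> and \<open>x\<close>, so that joint measurability is visible. Nesting the
    arguments of \<open>F\<close> as \<open>((y, c), x)\<close> fits the Tonelli interchanges that
    bring \<open>c\<close> outermost.\<close>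
  define h where "h = (\<lambda>c x. if c \<le> \<phi> x then 1 else 0 :: real)"
  define F where "F = (\<lambda>((y, c), x). ennreal (J (x - y) * \<bar>h c x - h c y\<bar>))"
  have F: "F \<in> borel_measurable ((lborel \<Otimes>\<^sub>M lborel) \<Otimes>\<^sub>M lborel)"
    unfolding F_def h_def split_beta by measurable
  have F_section: "(\<lambda>(x, c). F ((y, c), x)) \<in> borel_measurable (lborel \<Otimes>\<^sub>M lborel)" for y
    unfolding F_def h_def split_beta fst_conv snd_conv by measurable
  have F_integral: "(\<lambda>(y, c). \<integral>\<^sup>+x. F ((y, c), x) \<partial>lborel) \<in> borel_measurable (lborel \<Otimes>\<^sub>M lborel)"
    using lborel.borel_measurable_nn_integral_fst[OF F] by (simp add: case_prod_unfold)
  have ind: "indicat_real (superlevel c \<phi>) = h c" for c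
    by (auto simp: h_def superlevel_def indicator_def)
  \<comment> \<open>The heights whose superlevel set separates \<open>x\<close> from
    \<open>y\<close> form a half-open interval between the two values.\<close>
  have abs_diff: "ennreal \<bar>\<phi> x - \<phi> y\<bar> = (\<integral>\<^sup>+c. ennreal \<bar>h c x - h c y\<bar> \<partial>lborel)" for x y
  proof -
    have "(\<integral>\<^sup>+c. ennreal \<bar>h c x - h c y\<bar> \<partial>lborel)
        = (\<integral>\<^sup>+c. indicator {min (\<phi> x) (\<phi> y) <.. max (\<phi> x) (\<phi> y)} c \<partial>lborel)"
      by (intro nn_integral_cong) (auto simp: h_def indicator_def)
    also have "\<dots> = ennreal \<bar>\<phi> x - \<phi> y\<bar>"
      by (auto simp: min_def max_def)
    finally show ?thesis ..
  qed
  have [measurable]: "(\<lambda>c. h c x) \<in> borel_measurable borel" for x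
    unfolding h_def by measurable
  have "nonlocal_energy J \<phi> = (\<integral>\<^sup>+y. \<integral>\<^sup>+x. \<integral>\<^sup>+c. F ((y, c), x) \<partial>lborel \<partial>lborel \<partial>lborel)"
    unfolding nonlocal_energy_lborel
    by (intro nn_integral_cong) (simp add: F_def ennreal_mult' kernel_nonneg abs_diff nn_integral_cmult)
  also have "\<dots> = (\<integral>\<^sup>+y. \<integral>\<^sup>+c. \<integral>\<^sup>+x. F ((y, c), x) \<partial>lborel \<partial>lborel \<partial>lborel)"
    by (rule nn_integral_cong, rule lborel_pair.Fubini'[OF F_section, symmetric])
  also have "\<dots> = (\<integral>\<^sup>+c. \<integral>\<^sup>+y. \<integral>\<^sup>+x. F ((y, c), x) \<partial>lborel \<partial>lborel \<partial>lborel)"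
    by (rule lborel_pair.Fubini'[OF F_integral, symmetric])
  finally show ?thesis
    by (simp add: nonlocal_energy_lborel ind F_def)
qed

text \<open>\<open>S x\<close> is closed downwards, contains \<open>- B\<close> and is bounded by
  \<open>B\<close>. Weights of superlevel sets are left-continuous in the height, so the supremum is
  attained and \<open>S x\<close> is a closed half-line.\<close>

lemma median_threshold:
  assumes [measurable]: "\<phi> \<in> borel_measurable borel" and bound: "\<And>x. \<bar>\<phi> x\<bar> \<le> B"
  defines "S \<equiv> \<lambda>x. {c. 1 / 2 \<le> smear (superlevel c \<phi>) x}"
  shows "c \<le> Sup (S x) \<longleftrightarrow> c \<in> S x" and "\<bar>Sup (S x)\<bar> \<le> B"
proof -
  have meas [measurable]: "superlevel c \<phi> \<in> sets borel" for c
    unfolding superlevel_def by measurable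
  have "superlevel (- B) \<phi> = UNIV"
    using bound by (auto simp: superlevel_def abs_le_iff minus_le_iff)
  then have low: "- B \<in> S x"
    by (simp add: S_def smear_UNIV)
  have high: "c \<le> B" if "c \<in> S x" for c
  proof (rule ccontr)
    assume "\<not> c \<le> B"
    then have "\<phi> x < c" for x
      using bound[of x] by linarith
    then have "superlevel c \<phi> = {}"
      by (auto simp: superlevel_def not_le)
    with that show False by (simp add: S_def smear_empty)
  qed
  then have bdd: "bdd_above (S x)" by (auto simp: bdd_above_def)
  have down: "c \<in> S x" if "d \<in> S x" "c \<le> d" for c d
  proof -
    have "superlevel d \<phi> \<subseteq> superlevel c \<phi>" using that by (auto simp: superlevel_def)
    from smear_mono[OF this meas meas, of x] that(1) show ?thesis by (simp add: S_def)
  qed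
  have Sup_mem: "Sup (S x) \<in> S x"
  proof -
    \<comment> \<open>The approach is strictly from below: superlevel sets are defined by \<ge>, so
      their indicators at the heights \<open>d i\<close> converge at every point, including those
      where \<phi> equals the supremum.\<close>
    define d where "d = (\<lambda>i. Sup (S x) - inverse (real (Suc i)))"
    have d_lim: "d \<longlonglongrightarrow> Sup (S x)"
      unfolding d_def by (rule tendsto_eq_intros LIMSEQ_inverse_real_of_nat refl)+ simp
    have d_less: "d i < Sup (S x)" for i
      by (simp add: d_def)
    have d_mem: "d i \<in> S x" for i
    proof -
      obtain e where "e \<in> S x" "d i < e"
        using less_cSupD[of "S x" "d i"] d_less[of i] low by blast
      then show ?thesis by (auto intro: down)
    qed
    have "(\<lambda>i. smear (superlevel (d i) \<phi>) x) \<longlonglongrightarrow> smear (superlevel (Sup (S x)) \<phi>) x"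
      unfolding smear_def
    proof (rule integral_dominated_convergence[OF _ _ integrable_kernel_shift[of x]])
      show "AE y in lborel. (\<lambda>i. indicat_real (superlevel (d i) \<phi>) y * J (x - y))
          \<longlonglongrightarrow> indicat_real (superlevel (Sup (S x)) \<phi>) y * J (x - y)"
      proof (intro AE_I2 tendsto_mult_right tendsto_eventually)
        fix y
        show "eventually (\<lambda>i. indicat_real (superlevel (d i) \<phi>) y = indicat_real (superlevel (Sup (S x)) \<phi>) y) sequentially"
        proof (cases "\<phi> y < Sup (S x)")
          case True
          from order_tendstoD(1)[OF d_lim True] show ?thesis
            by (rule eventually_mono) (use True in \<open>auto simp: superlevel_def indicator_def\<close>)
        next
          case False
          then have "d i \<le> \<phi> y" for i using d_less[of i] by simp
          with False show ?thesis by (auto simp: superlevel_def indicator_def)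
        qed
      qed
    qed (use kernel_nonneg in \<open>auto simp: indicator_def\<close>)
    then have "1 / 2 \<le> smear (superlevel (Sup (S x)) \<phi>) x"
      by (rule LIMSEQ_le_const) (use d_mem in \<open>auto simp: S_def\<close>)
    then show ?thesis by (simp add: S_def)
  qed
  show "c \<le> Sup (S x) \<longleftrightarrow> c \<in> S x"
    using Sup_mem down cSup_upper[OF _ bdd] by blast
  show "\<bar>Sup (S x)\<bar> \<le> B"
    using high[OF Sup_mem] cSup_upper[OF low bdd] by (simp add: abs_le_iff)
qed

text \<open>Each superlevel set of \<open>\<phi>'\<close> is the thresholded superlevel set of
  \<phi> at the same height, so \<open>threshold_dissipates\<close> applies under the layer cake
  integral. Measurability and the bound are what the next step of the scheme asks for.\<close>

lemma median_step:
  assumes [measurable]: "\<phi> \<in> borel_measurable borel" and bound: "\<And>x. \<bar>\<phi> x\<bar> \<le> B"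
    and \<phi>': "\<And>x. \<phi>' x = Sup {c. 1 / 2 \<le> smear (superlevel c \<phi>) x}"
  shows "\<phi>' \<in> borel_measurable borel" and "\<bar>\<phi>' x\<bar> \<le> B"
    and "nonlocal_energy J \<phi>' \<le> nonlocal_energy J \<phi>"
proof -
  have meas [measurable]: "superlevel c \<phi> \<in> sets borel" for c
    unfolding superlevel_def by measurable
  have level: "superlevel c \<phi>' = {x. 1 / 2 \<le> smear (superlevel c \<phi>) x}" for c
    using median_threshold(1)[OF assms(1) bound] by (auto simp: superlevel_def[of c \<phi>'] \<phi>')
  show [measurable]: "\<phi>' \<in> borel_measurable borel"
    unfolding borel_measurable_iff_ge
  proof
    fix c
    have "{x. 1 / 2 \<le> smear (superlevel c \<phi>) x} \<in> sets borel" by measurable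
    then show "{w \<in> space borel. c \<le> \<phi>' w} \<in> sets borel"
      unfolding level[symmetric] by (simp add: superlevel_def)
  qed
  show "\<bar>\<phi>' x\<bar> \<le> B"
    unfolding \<phi>' by (rule median_threshold(2)[OF assms(1) bound])
  show "nonlocal_energy J \<phi>' \<le> nonlocal_energy J \<phi>"
    unfolding nonlocal_energy_layer_cake[OF assms(1)] nonlocal_energy_layer_cake[OF \<open>\<phi>' \<in> borel_measurable borel\<close>] level
    by (intro nn_integral_mono threshold_dissipates meas)
qed

end

section \<open>Reduction of the given kernel to a Borel kernel\<close>

lemma borel_even_representative:
  fixes K :: "'a::euclidean_space \<Rightarrow> real"
  assumes K: "K \<in> borel_measurable lebesgue" and nonneg: "\<And>x. K x \<ge> 0" and even: "\<And>x. K (- x) = K x"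
  obtains K1 where "K1 \<in> borel_measurable borel" "\<And>x. K1 x \<ge> 0" "\<And>x. K1 (- x) = K1 x" "AE x in lborel. K x = K1 x"
proof -
  obtain K0 where K0 [measurable]: "K0 \<in> borel_measurable borel" and eq: "AE x in lborel. K x = K0 x"
    using completion_ex_borel_measurable_real[OF K] by auto
  have "AE x in lborel. K (0 + (-1) *\<^sub>R x) = K0 (0 + (-1) *\<^sub>R x)"
    by (rule AE_lborel_affine[OF eq]) simp
  then have eq': "AE x in lborel. K x = K0 (- x)"
    by (simp add: even)
  show thesis
  proof
    \<comment> \<open>\<open>K0\<close> may fail to be nonnegative or even on a null set. Averaging
      its absolute value with the reflection repairs both everywhere and keeps almost everywhere
      equality with \<open>K\<close>.\<close>
    show "(\<lambda>x. (\<bar>K0 x\<bar> + \<bar>K0 (- x)\<bar>) / 2) \<in> borel_measurable borel" by measurable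
    show "AE x in lborel. K x = (\<bar>K0 x\<bar> + \<bar>K0 (- x)\<bar>) / 2"
      using eq eq' by eventually_elim (metis nonneg abs_of_nonneg add_divide_distrib field_sum_of_halves)
  qed auto
qed

text \<open>The factor in \<open>rescale\<close> cancels the Jacobian of the dilation, so the mass
  is kept and the transform at \<xi> is that of \<open>K\<close> at r \<xi>.\<close>

lemma rescaled_median_kernel:
  fixes K :: "'a::euclidean_space \<Rightarrow> real"
  assumes "K \<in> borel_measurable borel" "\<And>x. K x \<ge> 0" "\<And>x. K (- x) = K x"
    and "integrable lborel K" "(\<integral>x. K x \<partial>lborel) = 1"
    and "\<And>\<xi>. fourier K \<xi> \<in> \<real>\<^sub>\<ge>\<^sub>0" and "r > 0"
  shows "median_kernel (rescale r K)"
proof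
  note [measurable] = assms(1)
  have r: "rescale r K = (\<lambda>x. K (0 + inverse r *\<^sub>R x) / r ^ DIM('a))"
    by (simp add: rescale_def[abs_def])
  show int: "integrable lborel (rescale r K)"
    unfolding r using integrable_lborel_affine[OF assms(4), of "inverse r" 0] \<open>r > 0\<close> by simp
  show "0 \<le> rescale r K x" "rescale r K (- x) = rescale r K x" for x
    using assms(2,3,7) by (auto simp: rescale_def)
  show "(\<integral>x. rescale r K x \<partial>lborel) = 1"
  proof -
    have "(\<integral>x. rescale r K x \<partial>lborel) = \<bar>inverse r\<bar> ^ DIM('a) *\<^sub>R (\<integral>x. K (0 + inverse r *\<^sub>R x) \<partial>lborel)"
      unfolding r using \<open>r > 0\<close> by (simp add: power_inverse divide_inverse mult.commute)
    also have "\<dots> = (\<integral>x. K x \<partial>lborel)"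
      using \<open>r > 0\<close> by (intro integral_lborel_affine[symmetric]) auto
    finally show ?thesis using assms(5) by simp
  qed
  show "fourier (rescale r K) \<xi> \<in> \<real>\<^sub>\<ge>\<^sub>0" for \<xi>
  proof -
    have "fourier K (r *\<^sub>R \<xi>) = fourier (rescale r K) \<xi>"
      using \<open>r > 0\<close> int
      by (simp add: fourier_lborel)
         (subst integral_lborel_affine[of _ "inverse r" 0],
          auto simp: rescale_def scaleR_conv_of_real field_simps simp flip: integral_mult_right_zero)
    then show ?thesis
      using assms(6)[of "r *\<^sub>R \<xi>"] by simp
  qed
qed

text \<open>Reflection and translation preserve null sets, so the equality holds for every
  \<open>x\<close>, and medians agree pointwise rather than almost everywhere.\<close>

lemma superlevel_weight_AE_cong:
  fixes L J :: "'a::euclidean_space \<Rightarrow> real"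
  assumes eq: "AE x in lborel. L x = J x" and [measurable]: "J \<in> borel_measurable borel" "\<phi> \<in> borel_measurable borel"
  shows "superlevel_weight L \<phi> x c = (\<integral>y. indicator (superlevel c \<phi>) y * J (x - y) \<partial>lborel)"
proof -
  let ?g = "\<lambda>y. indicat_real (superlevel c \<phi>) y * J (x - y)"
  have meas [measurable]: "superlevel c \<phi> \<in> sets borel"
    unfolding superlevel_def by measurable
  have g [measurable]: "?g \<in> borel_measurable lborel" by simp
  have "AE y in lborel. L (x + (-1) *\<^sub>R y) = J (x + (-1) *\<^sub>R y)"
    by (rule AE_lborel_affine[OF eq]) simp
  then have ae: "AE y in lborel. ?g y = indicat_real (superlevel c \<phi>) y *\<^sub>R L (x - y)"
    by (rule eventually_mono) simp
  have g': "?g \<in> borel_measurable lebesgue"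
    using g by (rule measurable_completion)
  have "(\<integral>y. indicat_real (superlevel c \<phi>) y *\<^sub>R L (x - y) \<partial>lebesgue) = (\<integral>y. ?g y \<partial>lebesgue)"
    \<comment> \<open>Completeness of the measure makes the integrand with \<open>L\<close>
      measurable, as it equals a measurable function almost everywhere.\<close>
    using borel_measurable_AE[OF g' AE_completion[OF ae]] g' AE_completion[OF ae]
    by (intro integral_cong_AE) auto
  also have "\<dots> = (\<integral>y. ?g y \<partial>lborel)"
    by (rule integral_completion[OF g])
  finally show ?thesis
    by (simp add: superlevel_weight_def set_lebesgue_integral_def)
qed

lemma nonlocal_energy_AE_cong:
  fixes L J :: "'a::euclidean_space \<Rightarrow> real"
  assumes eq: "AE x in lborel. L x = J x"
  shows "nonlocal_energy L \<phi> = nonlocal_energy J \<phi>"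
  unfolding nonlocal_energy_lborel
proof (rule nn_integral_cong, rule nn_integral_cong_AE)
  fix y :: 'a
  have "AE x in lborel. L (- y + 1 *\<^sub>R x) = J (- y + 1 *\<^sub>R x)"
    by (rule AE_lborel_affine[OF eq]) simp
  then show "AE x in lborel. ennreal (L (x - y) * \<bar>\<phi> x - \<phi> y\<bar>) = ennreal (J (x - y) * \<bar>\<phi> x - \<phi> y\<bar>)"
    by (rule eventually_mono) simp
qed

theorem proposition1:
  fixes K :: "'a::euclidean_space \<Rightarrow> real" and k :: real and \<phi> :: "nat \<Rightarrow> 'a \<Rightarrow> real"
  assumes "\<And>x. K x \<ge> 0"
    and "radially_symmetric K"
    and "rapid_decay K"
    and "unit_mass K"
    and "\<And>\<xi>. fourier K \<xi> \<in> \<real>\<^sub>\<ge>\<^sub>0"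
    and "k > 0"
    and "bounded (range (\<phi> 0))"
    and "continuous_on UNIV (\<phi> 0)"
    and "\<And>n x. \<phi> (Suc n) x = weighted_median (rescale (sqrt (2 * k)) K) (\<phi> n) x"
  shows "\<forall>n. nonlocal_energy (rescale (sqrt (2 * k)) K) (\<phi> (Suc n))
               \<le> nonlocal_energy (rescale (sqrt (2 * k)) K) (\<phi> n)"
proof -
  define r where "r = sqrt (2 * k)"
  have "r > 0" using assms(6) by (simp add: r_def)
  have K: "integrable lebesgue K" "(\<integral>x. K x \<partial>lebesgue) = 1"
    using assms(4) by (auto simp: unit_mass_def)
  then have K_meas: "K \<in> borel_measurable lebesgue" by auto
  have even: "K (- x) = K x" for x
    using assms(2) norm_minus_cancel unfolding radially_symmetric_def by blast
  obtain K1 where K1 [measurable]: "K1 \<in> borel_measurable borel"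
      and K1_props: "\<And>x. K1 x \<ge> 0" "\<And>x. K1 (- x) = K1 x" and eq: "AE x in lborel. K x = K1 x"
    using borel_even_representative[OF K_meas assms(1) even] by blast
  have K1_leb: "K1 \<in> borel_measurable lebesgue"
    by (rule measurable_completion) simp
  have eq_leb: "AE x in lebesgue. K x = K1 x"
    by (rule AE_completion[OF eq])
  have "integrable lebesgue K1"
    by (rule integrable_cong_AE_imp[OF K(1) K1_leb eq_leb])
  then have K1_int: "integrable lborel K1"
    by (simp add: integrable_completion)
  have "(\<integral>x. K1 x \<partial>lborel) = (\<integral>x. K1 x \<partial>lebesgue)"
    by (rule integral_completion[symmetric]) simp
  also have "\<dots> = 1"
    using integral_cong_AE[OF K_meas K1_leb eq_leb] K(2) by simp
  finally have K1_mass: "(\<integral>x. K1 x \<partial>lborel) = 1" .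
  have "fourier K1 \<xi> = fourier K \<xi>" for \<xi>
    unfolding fourier_def
  proof (rule integral_cong_AE)
    have cis_meas: "(\<lambda>x. cis (- (\<xi> \<bullet> x))) \<in> borel_measurable lebesgue"
      by (rule measurable_completion) measurable
    note [measurable] = K_meas K1_leb cis_meas
    show "(\<lambda>x. complex_of_real (K1 x) * cis (- (\<xi> \<bullet> x))) \<in> borel_measurable lebesgue"
      "(\<lambda>x. complex_of_real (K x) * cis (- (\<xi> \<bullet> x))) \<in> borel_measurable lebesgue"
      by measurable
    show "AE x in lebesgue. complex_of_real (K1 x) * cis (- (\<xi> \<bullet> x)) = complex_of_real (K x) * cis (- (\<xi> \<bullet> x))"
      using eq_leb by (rule eventually_mono) simp
  qed
  then interpret median_kernel "rescale r K1"
    by (intro rescaled_median_kernel K1 K1_props K1_int K1_mass \<open>r > 0\<close>) (simp add: assms(5))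
  have "AE x in lborel. K (0 + inverse r *\<^sub>R x) = K1 (0 + inverse r *\<^sub>R x)"
    using \<open>r > 0\<close> by (intro AE_lborel_affine[OF eq]) simp
  then have eq_r: "AE x in lborel. rescale r K x = rescale r K1 x"
    by (rule eventually_mono) (simp add: rescale_def)
  \<comment> \<open>The scheme driven by \<open>K\<close> coincides at every point with the one
    driven by the Borel kernel, so the locale results apply to it.\<close>
  have step: "\<phi> (Suc n) x = Sup {c. 1 / 2 \<le> smear (superlevel c (\<phi> n)) x}"
    if "\<phi> n \<in> borel_measurable borel" for n x
    unfolding assms(9) r_def[symmetric] weighted_median_def
    by (simp add: superlevel_weight_AE_cong[OF eq_r kernel_measurable that] smear_def)
  obtain B where B: "\<And>x. \<bar>\<phi> 0 x\<bar> \<le> B"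
    using assms(7) by (auto simp: bounded_iff)
  \<comment> \<open>Borel measurability, not continuity, is the invariant carried along the scheme,
    with one bound \<open>B\<close> for all steps.\<close>
  have "\<phi> n \<in> borel_measurable borel \<and> (\<forall>x. \<bar>\<phi> n x\<bar> \<le> B)" for n
  proof (induction n)
    case 0
    show ?case using B assms(8) by (auto intro: borel_measurable_continuous_onI)
  next
    case (Suc n)
    then have *: "\<phi> n \<in> borel_measurable borel" "\<And>x. \<bar>\<phi> n x\<bar> \<le> B" by auto
    show ?case using median_step(1,2)[OF * step[OF *(1)]] by blast
  qed
  then have "nonlocal_energy (rescale r K1) (\<phi> (Suc n)) \<le> nonlocal_energy (rescale r K1) (\<phi> n)" for n
    using median_step(3)[of "\<phi> n" B] step by blast
  then show ?thesis
    unfolding r_def[symmetric] nonlocal_energy_AE_cong[OF eq_r] by blast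
qed

end
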